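(* Let $p$ be a prime with $p\equiv 1\pmod 3$. Then $$\sum_{\substack{k=0\\ k\neq (p-1)/3}}^{(p-1)/2}\frac{\binom{2k}{k}}{3k+1}\equiv 0\pmod p.$$
   Context: For $0\le k\le (p-1)/2$ with $k\neq (p-1)/3$, the integer $3k+1$ is not divisible by $p$, so each summand is a rational number whose denominator is prime to $p$; the congruence is understood in the ring of rationals with denominators prime to $p$ (equivalently in $\mathbb{Z}_p$). *)

theory Defs
  imports Complex_Main "HOL-Computational_Algebra.Primes"
begin

definition cong_zero_loc :: "rat \<Rightarrow> nat \<Rightarrow> bool" where
  "cong_zero_loc q p \<longleftrightarrow>
     (\<exists>a b :: int. b \<noteq> 0 \<and> \<not> int p dvd b \<and> int p dvd a \<and> q = of_int a / of_int b)"

end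

theory Submission
  imports Defs
    "HOL-Computational_Algebra.Formal_Power_Series"
    "HOL-Number_Theory.Residue_Primitive_Roots"
    "HOL-Computational_Algebra.Polynomial"
begin

text \<open>
  Write \<open>p = 3m + 1\<close> and work modulo \<open>p\<close>, where \<open>-2/3 = 2m\<close>. Put \<open>z = x(1 - x)\<close>; then
  \<open>1 - 4z = (1 - 2x)^2\<close>, so \<open>\<Sum>k. C(2k,k) z^k = (1 - 2x)^(p-1)\<close>. Consequently
  \<open>Q = \<Sum>k. C(2k,k) z^(2m+1+k) / (2m+1+k)\<close> (without the term \<open>k = m\<close>), whose value at \<open>z = 1\<close>
  is three times the sum in question, and the truncated antiderivatives \<open>G\<close> of \<open>z^(2m)\<close> and
  \<open>L = \<Sum>x^j / j\<close> satisfy, by comparing derivatives,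
  \<open>Q = (1 - 2x^p) G + c x^p L + d (x^p - x^(2p))\<close>, where \<open>c = C(2m,m)\<close>.
  The constant \<open>d\<close> is the coefficient of \<open>x^p\<close> in \<open>Q\<close>, a multiple of
  \<open>C(2m,m) (H_(2m) - H_m)\<close>, and this vanishes because \<open>i \<mapsto> p - i\<close> permutes \<open>{m+1..2m}\<close>.
  Now evaluate at a primitive sixth root of unity \<open>t\<close>, where \<open>z = 1\<close>. The substitutions
  \<open>x \<mapsto> 1 - x\<close> and \<open>x \<mapsto> 1/x\<close> agree at \<open>t\<close> and act differently on \<open>L\<close> and \<open>G\<close>, which forces
  \<open>c L(t) = G(t) = 0\<close>, hence \<open>Q(t) = 0\<close>.
\<close>

section \<open>Index reversal and recurrences for binomial coefficients\<close>

lemma cong_sum_minus_reflect: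
  fixes a b :: "nat \<Rightarrow> int"
  assumes "\<And>j. j \<le> N \<Longrightarrow> [a (N - j) = c * b j] (mod q)"
  shows "[(\<Sum>j\<le>N. a j) = c * (\<Sum>j\<le>N. b j)] (mod q)"
proof -
  have "(\<Sum>j\<le>N. a j) = (\<Sum>j\<le>N. a (N - j))"
    by (rule sum.reindex_bij_witness[of _ "\<lambda>j. N - j" "\<lambda>j. N - j"]) auto
  also have "[\<dots> = (\<Sum>j\<le>N. c * b j)] (mod q)"
    by (rule cong_sum) (use assms in auto)
  finally show ?thesis by (simp add: sum_distrib_left)
qed

lemma int_Suc_times_binomial: "int (Suc k) * int (n choose Suc k) = (int n - int k) * int (n choose k)"
proof (cases "k \<le> n")
  case True
  have "Suc k * (n choose Suc k) = (n - k) * (n choose k)"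
    by (metis binomial_absorb_comp binomial_absorption)
  then have "int (Suc k * (n choose Suc k)) = int ((n - k) * (n choose k))" by simp
  then show ?thesis using True by (simp only: of_nat_mult of_nat_diff)
qed (simp add: binomial_eq_0)

lemma fact_times_binomial_prod: "fact k * int (n choose k) = (\<Prod>i<k. int n - int i)"
proof (induction k)
  case (Suc k)
  have "fact (Suc k) * int (n choose Suc k) = fact k * (int (Suc k) * int (n choose Suc k))"
    by (simp add: algebra_simps)
  also have "\<dots> = (int n - int k) * (fact k * int (n choose k))"
    by (subst int_Suc_times_binomial) simp
  finally show ?case using Suc by simp
qed simp

lemma central_binomial_Suc: "Suc k * (2 * Suc k choose Suc k) = (4 * k + 2) * (2 * k choose k)"
proof -
  have 1: "Suc k * (2 * Suc k choose Suc k) = 2 * Suc k * (Suc (2 * k) choose k)"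
    using Suc_times_binomial[of k "Suc (2*k)"] by simp
  have 2: "Suc (2*k) choose Suc k = Suc (2*k) choose k"
    using binomial_symmetric[of k "Suc (2*k)"] by (simp add: Suc_diff_le)
  have 3: "Suc k * (Suc (2 * k) choose Suc k) = Suc (2*k) * (2 * k choose k)"
    using Suc_times_binomial[of k "2*k"] by simp
  show ?thesis unfolding 1 using 2 3 by simp
qed

lemma central_binomial_half: "j > 0 \<Longrightarrow> 2 * ((2 * j - 1) choose j) = (2 * j choose j)"
proof (cases j)
  case (Suc i)
  have "Suc (2*i) choose Suc i = Suc (2*i) choose i"
    using binomial_symmetric[of i "Suc (2*i)"] by (simp add: Suc_diff_le)
  then show ?thesis using Suc by simp
qed simp

section \<open>The power series (1 - 4x)^(-1/2) of the central binomial coefficients\<close>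

definition cbin_fps :: "int fps" where
  "cbin_fps = Abs_fps (\<lambda>k. int (2 * k choose k))"

text \<open>The recurrence (k+1) C(2k+2,k+1) = (4k+2) C(2k,k), read as a differential
  equation.\<close>

lemma cbin_fps_deriv: "(1 - 4 * fps_X) * fps_deriv cbin_fps = 2 * cbin_fps"
proof (rule fps_ext)
  fix k
  have *: "int (Suc k) * int (2 * Suc k choose Suc k) = (4 * int k + 2) * int (2 * k choose k)" for k
    using arg_cong[OF central_binomial_Suc[of k], of int] by (simp only: of_nat_mult of_nat_add) simp
  have "fps_nth ((1 - 4 * fps_X) * fps_deriv cbin_fps) k
      = fps_nth (fps_deriv cbin_fps) k - 4 * fps_nth (fps_X * fps_deriv cbin_fps) k"
    by (simp only: left_diff_distrib mult.assoc fps_sub_nth numeral_fps_const fps_mult_left_const_nth mult_1_left)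
  also have "\<dots> = 2 * fps_nth cbin_fps k"
    using *[of k] by (cases k) (simp_all add: cbin_fps_def algebra_simps)
  finally show "fps_nth ((1 - 4 * fps_X) * fps_deriv cbin_fps) k = fps_nth (2 * cbin_fps) k"
    by (simp only: numeral_fps_const fps_mult_left_const_nth)
qed

text \<open>By the differential equation the left side has derivative 0, so only its constant term
  survives.\<close>

lemma cbin_fps_square: "(1 - 4 * fps_X) * cbin_fps\<^sup>2 = 1"
proof -
  have "fps_deriv ((1 - 4 * fps_X) * cbin_fps\<^sup>2)
      = 2 * cbin_fps * ((1 - 4 * fps_X) * fps_deriv cbin_fps) - 4 * cbin_fps\<^sup>2"
    by (simp add: power2_eq_square algebra_simps)
  also have "\<dots> = 0"
    unfolding cbin_fps_deriv by (simp add: power2_eq_square algebra_simps)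
  finally have "(1 - 4 * fps_X) * cbin_fps\<^sup>2 = fps_const (fps_nth ((1 - 4 * fps_X) * cbin_fps\<^sup>2) 0)"
    by (rule fps_deriv_eq_0_iff[THEN iffD1])
  also have "fps_nth ((1 - 4 * fps_X) * cbin_fps\<^sup>2) 0 = 1"
    by (simp add: cbin_fps_def power2_eq_square)
  finally show ?thesis by simp
qed

section \<open>Inverses, Fermat's theorem and binomial coefficients modulo p\<close>

locale prime_mod_3 =
  fixes p m :: nat
  assumes prime_p: "prime p" and p_eq: "p = 3 * m + 1"
begin

lemma p_odd: "odd p"
proof -
  have "p \<noteq> 2" using p_eq by presburger
  then show ?thesis using prime_p prime_odd_nat prime_ge_2_nat[of p] by force
qed

lemma m_even: "even m" and m_ge_2: "m \<ge> 2"
proof -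
  show "even m" using p_odd p_eq by simp
  moreover have "m \<noteq> 0" using prime_p p_eq by (cases m) auto
  ultimately show "m \<ge> 2" by (metis dvd_imp_le neq0_conv)
qed

lemma p_ge_7: "p \<ge> 7"
  using m_ge_2 p_eq by linarith

lemma prime_int_p: "prime (int p)"
  using prime_p by simp

text \<open>An inverse modulo \<open>p\<close> with \<open>iv k\<close> congruent to 0 for \<open>p dvd k\<close>, so excluded terms drop out by themselves.\<close>

definition iv :: "int \<Rightarrow> int" where
  "iv k = k ^ (p - 2)"

lemma fermat: "[k ^ p = k] (mod int p)"
proof (cases "int p dvd k")
  case True
  then show ?thesis
    using prime_gt_0_nat[OF prime_p] by (simp add: cong_iff_dvd_diff dvd_power_same dvd_diff dvd_trans[OF _ dvd_power])
next
  case False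
  obtain a where a: "[k = int a] (mod int p)"
    by (metis prime_gt_0_nat[OF prime_p] cong_sym cong_mod_left cong_refl nonneg_int_cases of_nat_0_less_iff pos_mod_sign)
  then have "\<not> p dvd a" using False by (metis cong_0_iff cong_trans int_dvd_int_iff)
  then have "[a ^ (p - 1) = 1] (mod p)" using fermat_theorem prime_p by blast
  then have "[int a ^ (p - 1) = 1] (mod int p)" by (metis cong_int_iff of_nat_1 of_nat_power)
  then have "[int a ^ (p - 1) * int a = 1 * int a] (mod int p)" by (rule cong_mult) simp
  then have "[int a ^ p = int a] (mod int p)"
    using power_minus_mult[OF prime_gt_0_nat[OF prime_p], of "int a"] by simp
  then show ?thesis using a by (meson cong_pow cong_sym cong_trans)
qed

lemma iv_eq: "[k * iv k = (if int p dvd k then 0 else 1)] (mod int p)"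
proof -
  have *: "k * iv k = k ^ (p - 1)" "k ^ p = k * k ^ (p - 1)"
    using power_Suc[of k "p - 2"] power_Suc[of k "p - 1"] p_ge_7
    by (auto simp: iv_def Suc_diff_Suc numeral_2_eq_2)
  show ?thesis
  proof (cases "int p dvd k")
    case True
    then show ?thesis by (simp add: cong_0_iff)
  next
    case False
    have "[k * k ^ (p - 1) = k * 1] (mod int p)" using fermat[of k] * by simp
    then have "[k ^ (p - 1) = 1] (mod int p)"
      using False prime_int_p by (metis cong_mult_lcancel coprime_commute prime_imp_coprime)
    then show ?thesis using False * by simp
  qed
qed

lemma iv_cong: "[a = b] (mod int p) \<Longrightarrow> [iv a = iv b] (mod int p)"
  by (simp add: iv_def cong_pow)

lemma iv_minus: "iv (- k) = - iv k"
  using p_odd p_ge_7 by (simp add: iv_def)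

lemma iv_mult: "iv (a * b) = iv a * iv b"
  by (simp add: iv_def power_mult_distrib)

lemma iv_0: "iv 0 = 0"
  using p_ge_7 by (simp add: iv_def)

lemma iv_p: "[iv (int p) = 0] (mod int p)"
  using iv_cong[of "int p" 0] by (simp add: iv_0 cong_0_iff)

lemma iv_reflect: "[iv (int p * c - k) = - iv k] (mod int p)"
  using iv_cong[of "int p * c - k" "- k"] by (simp add: iv_minus cong_iff_dvd_diff)

lemma cong_cancel:
  "\<not> int p dvd k \<Longrightarrow> [k * a = k * b] (mod int p) \<Longrightarrow> [a = b] (mod int p)"
  by (metis prime_int_p cong_mult_lcancel coprime_commute prime_imp_coprime)

lemma not_dvd_small: "0 < k \<Longrightarrow> k < p \<Longrightarrow> \<not> int p dvd int k"
  using nat_dvd_not_less by auto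

text \<open>For a primitive root \<open>g\<close>, \<open>g ^ m\<close> is a nontrivial cube root of
  unity since p - 1 = 3m; its negative is the required \<open>t\<close>.\<close>

lemma sixth_root_exists: "\<exists>t. int p dvd t\<^sup>2 - t + 1"
proof -
  obtain g where g: "residue_primroot p g"
    using prime_primitive_root_exists[of p] prime_p prime_gt_1_nat by blast
  have ord: "ord p g = p - 1"
    using g prime_p by (auto simp: residue_primroot_def totient_prime)
  have "[g ^ (p - 1) = 1] (mod p)" using ord_divides[of g "p - 1" p] ord by simp
  then have "[int g ^ (3 * m) = 1] (mod int p)"
    using p_eq by (metis add_diff_cancel_right' cong_int_iff of_nat_1 of_nat_power)
  then have "int p dvd (int g ^ m - 1) * ((int g ^ m)\<^sup>2 + int g ^ m + 1)"
    by (simp add: cong_iff_dvd_diff mult.commute[of 3] power_mult algebra_simps power2_eq_square power3_eq_cube)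
  moreover have "\<not> int p dvd int g ^ m - 1"
  proof
    assume "int p dvd int g ^ m - 1"
    then have "[int g ^ m = 1] (mod int p)" by (simp add: cong_iff_dvd_diff)
    then have "[g ^ m = 1] (mod p)" by (metis cong_int_iff of_nat_1 of_nat_power)
    then have "3 * m dvd m" using ord_divides[of g m p] ord p_eq by simp
    then show False using m_ge_2 by (auto dest: dvd_imp_le)
  qed
  ultimately have "int p dvd (int g ^ m)\<^sup>2 + int g ^ m + 1"
    using prime_int_p prime_dvd_mult_iff by blast
  then have "int p dvd (- (int g ^ m))\<^sup>2 - (- (int g ^ m)) + 1" by simp
  then show ?thesis by blast
qed

definition n :: nat where "n = (p - 1) div 2"

lemma two_n: "2 * n = p - 1"
  using p_odd by (simp add: n_def)

text \<open>Modulo \<open>p\<close> the number \<open>n\<close> is -1/2, and C(2k,k) = (-4)^k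
  C(-1/2,k).\<close>

lemma central_binomial_cong:
  "k \<le> n \<Longrightarrow> [int (2 * k choose k) = int (n choose k) * (- 4) ^ k] (mod int p)"
proof (induction k)
  case (Suc k)
  have pn: "int p = 2 * int n + 1" using two_n prime_gt_0_nat[OF prime_p] by linarith
  have "int (Suc k) * int (2 * Suc k choose Suc k) = (4 * int k + 2) * int (2 * k choose k)"
    using arg_cong[OF central_binomial_Suc[of k], of int] by (simp only: of_nat_mult of_nat_add) simp
  also have "[\<dots> = (- 4 * (int n - int k)) * (int (n choose k) * (- 4) ^ k)] (mod int p)"
  proof (rule cong_mult)
    \<comment> \<open>The two sides differ by 4n + 2 = 2p.\<close>
    show "[4 * int k + 2 = - 4 * (int n - int k)] (mod int p)"
      unfolding cong_iff_dvd_diff pn by (rule dvdI[of _ _ 2]) simp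
  qed (use Suc in simp)
  also have "(- 4 * (int n - int k)) * (int (n choose k) * (- 4) ^ k)
     = int (Suc k) * int (n choose Suc k) * (- 4) ^ Suc k"
    by (subst int_Suc_times_binomial) (simp add: algebra_simps)
  finally have "[int (Suc k) * int (2 * Suc k choose Suc k)
      = int (Suc k) * (int (n choose Suc k) * (- 4) ^ Suc k)] (mod int p)" by (simp only: mult.assoc)
  then show ?case by (rule cong_cancel[rotated]) (use Suc.prems two_n not_dvd_small[of "Suc k"] p_ge_7 in \<open>simp del: of_nat_Suc\<close>)
qed simp

text \<open>Reducing each factor p - j - i to -(j + i) turns j! C(p-j,j) into (-1)^j j! C(2j-1,j),
  and j! is invertible. The factor 2 then produces C(2j,j).\<close>

lemma binomial_p_minus:
  assumes "0 < j" "2 * j < p"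
  shows "[2 * ((- 1) ^ j * int ((p - j) choose j)) = int (2 * j choose j)] (mod int p)"
proof -
  have "fact j * ((- 1) ^ j * int ((p - j) choose j)) = (\<Prod>i<j. - (int (p - j) - int i))"
    unfolding prod_uminus fact_times_binomial_prod[symmetric] by simp
  also have "[\<dots> = (\<Prod>i<j. int j + int i)] (mod int p)"
    by (rule cong_prod) (use assms in \<open>simp add: cong_iff_dvd_diff of_nat_diff\<close>)
  also have "(\<Prod>i<j. int j + int i) = (\<Prod>i<j. int (2 * j - 1) - int i)"
    by (rule prod.reindex_bij_witness[of _ "\<lambda>i. j - 1 - i" "\<lambda>i. j - 1 - i"]) auto
  also have "\<dots> = fact j * int ((2 * j - 1) choose j)"
    by (rule fact_times_binomial_prod[symmetric])
  finally have "[fact j * ((- 1) ^ j * int ((p - j) choose j)) = fact j * int ((2 * j - 1) choose j)] (mod int p)" .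
  moreover have "\<not> int p dvd fact j"
    using prime_dvd_fact_iff[of p j] prime_p assms by (metis int_dvd_int_iff leD le_add1 le_trans mult_2 of_nat_fact)
  ultimately have "[(- 1) ^ j * int ((p - j) choose j) = int ((2 * j - 1) choose j)] (mod int p)"
    by (rule cong_cancel[rotated])
  then have "[2 * ((- 1) ^ j * int ((p - j) choose j)) = 2 * int ((2 * j - 1) choose j)] (mod int p)"
    by (rule cong_mult[OF cong_refl])
  then show ?thesis using central_binomial_half[OF assms(1)] by (metis of_nat_mult of_nat_numeral)
qed

subsection \<open>A harmonic convolution of central binomial coefficients\<close>

text \<open>With f the central binomial series and g the sum of C(2j,j) x^j / j, x g' = f - 1 and (1
  - 4x) f^2 = 1 give x (1 - 4x) (f g)' = 2 x f g + 1 - f + 4 x f. The claim is the coefficient of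
  x^(k+1).\<close>

lemma central_harmonic_recurrence:
  fixes V :: "nat \<Rightarrow> int"
  defines "V \<equiv> \<lambda>k. \<Sum>j\<le>k. int (2 * (k - j) choose (k - j)) * int (2 * j choose j) * iv (int j)"
  assumes "Suc k < p"
  shows "[int (Suc k) * V (Suc k) = (4 * int k + 2) * V k
           + 4 * int (2 * k choose k) - int (2 * Suc k choose Suc k)] (mod int p)"
proof -
  define f where "f = cbin_fps"
  define g where "g = Abs_fps (\<lambda>j. int (2 * j choose j) * iv (int j))"
  \<comment> \<open>The error in x g' = f - 1; its coefficients are divisible by \<open>p\<close>
    below degree \<open>p\<close>, which covers degree \<open>Suc k\<close>.\<close>
  define r where "r = fps_X * fps_deriv g - f + 1"
  define x :: "int fps" where "x = fps_X"
  have V: "V k = fps_nth (f * g) k" for k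
    unfolding V_def mult.commute[of f] fps_mult_nth
    by (simp add: f_def g_def cbin_fps_def atLeast0AtMost mult_ac)
  have r0: "int p dvd fps_nth r j" if "j < p" for j
  proof (cases j)
    case 0
    then show ?thesis by (simp add: r_def f_def g_def cbin_fps_def)
  next
    case (Suc i)
    have "fps_nth r j = int (2 * j choose j) * (int j * iv (int j) - 1)"
      using Suc by (simp add: r_def f_def g_def cbin_fps_def algebra_simps)
    moreover have "int p dvd int j * iv (int j) - 1"
      using iv_eq[of "int j"] not_dvd_small[of j] that Suc by (auto simp: cong_iff_dvd_diff)
    ultimately show ?thesis by simp
  qed
  have f1: "(1 - 4 * x) * fps_deriv f = 2 * f" and f2: "(1 - 4 * x) * f\<^sup>2 = 1"
    unfolding f_def x_def by (rule cbin_fps_deriv cbin_fps_square)+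
  have g': "x * fps_deriv g = f - 1 + r" unfolding r_def x_def by simp
  have "x * ((1 - 4 * x) * fps_deriv (f * g))
     = x * ((1 - 4 * x) * fps_deriv f) * g + (1 - 4 * x) * f * (x * fps_deriv g)"
    by (simp add: algebra_simps)
  also have "\<dots> = 2 * x * (f * g) + (1 - 4 * x) * f\<^sup>2 - f + 4 * x * f + (1 - 4 * x) * f * r"
    unfolding f1 g' by (simp add: algebra_simps power2_eq_square)
  finally have e': "x * ((1 - 4 * x) * fps_deriv (f * g))
      = 2 * x * (f * g) + 1 - f + 4 * x * f + (1 - 4 * x) * f * r"
    unfolding f2 .
  define h where "h = f * g"
  define R where "R = (1 - 4 * x) * f * r"
  have e: "x * fps_deriv h - fps_const 4 * (x * (x * fps_deriv h))
      = fps_const 2 * (x * h) + 1 - f + fps_const 4 * (x * f) + R"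
    using e' unfolding h_def[symmetric] R_def[symmetric]
    by (simp add: algebra_simps numeral_fps_const)
  have "int p dvd fps_nth R (Suc k)"
    unfolding R_def
    unfolding fps_mult_nth[of _ r] by (rule dvd_sum) (use r0 assms in auto)
  moreover have "fps_nth R (Suc k)
     = int (Suc k) * V (Suc k) - (4 * int k + 2) * V k - 4 * fps_nth f k + fps_nth f (Suc k)"
    using arg_cong[OF e, of "\<lambda>h. fps_nth h (Suc k)"]
    by (cases k) (simp_all add: x_def V h_def[symmetric] algebra_simps)
  ultimately show ?thesis
    by (simp add: cong_iff_dvd_diff f_def cbin_fps_def algebra_simps)
qed

text \<open>The right side, 2 C(2k,k) (H_(2k) - H_k), satisfies the same recurrence and also starts
  at 0. The bound on \<open>k\<close> makes every inverse involved a genuine one.\<close>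

lemma central_harmonic_convolution:
  assumes "2 * k < p"
  shows "[(\<Sum>j\<le>k. int (2 * (k - j) choose (k - j)) * int (2 * j choose j) * iv (int j))
           = 2 * int (2 * k choose k) * (\<Sum>i\<in>{k<..2 * k}. iv (int i))] (mod int p)"
  using assms
proof (induction k)
  case 0
  then show ?case by (simp add: iv_0)
next
  case (Suc k)
  let ?V = "\<lambda>k. \<Sum>j\<le>k. int (2 * (k - j) choose (k - j)) * int (2 * j choose j) * iv (int j)"
  let ?f = "\<lambda>k. int (2 * k choose k)"
  let ?H = "\<lambda>k. \<Sum>i\<in>{k<..2 * k}. iv (int i)"
  have H: "?H (Suc k) = ?H k - iv (int (Suc k)) + iv (int (2 * k + 1)) + iv (int (2 * k + 2))"
  proof -
    have "{k<..2 * Suc k} = insert (2 * k + 2) (insert (2 * k + 1) {k<..2 * k})" by auto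
    then have "(\<Sum>i\<in>{k<..2 * Suc k}. iv (int i)) = ?H k + iv (int (2 * k + 1)) + iv (int (2 * k + 2))"
      by simp
    moreover have "{k<..2 * Suc k} = insert (Suc k) {Suc k<..2 * Suc k}" by auto
    then have "(\<Sum>i\<in>{k<..2 * Suc k}. iv (int i)) = iv (int (Suc k)) + ?H (Suc k)" by simp
    ultimately show ?thesis by simp
  qed
  have f: "int (Suc k) * ?f (Suc k) = (4 * int k + 2) * ?f k"
    using arg_cong[OF central_binomial_Suc[of k], of int] by (simp only: of_nat_mult of_nat_add) simp
  have "int p dvd int (Suc k) * iv (int (Suc k)) - 1" (is "_ dvd ?a")
       "int p dvd int (2 * k + 1) * iv (int (2 * k + 1)) - 1" (is "_ dvd ?b")
       "int p dvd int (2 * k + 2) * iv (int (2 * k + 2)) - 1" (is "_ dvd ?c")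
    using iv_eq[of "int (Suc k)"] iv_eq[of "int (2 * k + 1)"] iv_eq[of "int (2 * k + 2)"]
      not_dvd_small[of "Suc k"] not_dvd_small[of "2 * k + 1"] not_dvd_small[of "2 * k + 2"] Suc.prems
    by (auto simp: cong_iff_dvd_diff)
  moreover have "int p dvd ?V k - 2 * ?f k * ?H k" (is "_ dvd ?d")
    using Suc by (simp add: cong_iff_dvd_diff)
  moreover have "int p dvd int (Suc k) * ?V (Suc k) - ((4 * int k + 2) * ?V k + 4 * ?f k - ?f (Suc k))"
    (is "_ dvd ?e")
    using central_harmonic_recurrence[of k] Suc.prems by (simp add: cong_iff_dvd_diff)
  \<comment> \<open>The multipliers come from expanding (k+1) * 2 f(k+1) H(k+1) by \<open>H\<close>
    and \<open>f\<close> and replacing each product of a number with its inverse by 1.\<close>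
  ultimately have "int p dvd ?e + (4 * int k + 2) * ?d - 4 * ?f k * ?b + 2 * ?f (Suc k) * ?a - ?f (Suc k) * ?c"
    by (meson dvd_add dvd_diff dvd_mult)
  also have "?e + (4 * int k + 2) * ?d - 4 * ?f k * ?b + 2 * ?f (Suc k) * ?a - ?f (Suc k) * ?c
     = int (Suc k) * ?V (Suc k) - int (Suc k) * (2 * ?f (Suc k) * ?H (Suc k))"
    (is "?l = ?r")
  proof -
    have "?l - ?r = 2 * (?H k + iv (int (2 * k + 1))) * (int (Suc k) * ?f (Suc k) - (4 * int k + 2) * ?f k)"
      unfolding H by (simp add: algebra_simps)
    then show ?thesis using f by simp
  qed
  finally have "[int (Suc k) * ?V (Suc k) = int (Suc k) * (2 * ?f (Suc k) * ?H (Suc k))] (mod int p)"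
    by (simp only: cong_iff_dvd_diff)
  then show ?case
    by (rule cong_cancel[rotated]) (use Suc.prems not_dvd_small[of "Suc k"] in simp)
qed

lemma central_harmonic_vanishes:
  "int p dvd (\<Sum>j\<le>m. int (2 * (m - j) choose (m - j)) * int (2 * j choose j) * iv (int j))"
proof -
  let ?H = "\<Sum>i\<in>{m<..2 * m}. iv (int i)"
  have "?H = (\<Sum>i\<in>{m<..2 * m}. iv (int (p - i)))"
    by (rule sum.reindex_bij_witness[of _ "\<lambda>i. p - i" "\<lambda>i. p - i"]) (auto simp: p_eq)
  also have "[\<dots> = (\<Sum>i\<in>{m<..2 * m}. - iv (int i))] (mod int p)"
    by (rule cong_sum) (use iv_reflect[of 1] p_eq in \<open>simp add: of_nat_diff\<close>)
  finally have "int p dvd 2 * ?H"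
    by (simp add: cong_iff_dvd_diff sum_negf)
  then have "int p dvd 2 * int (2 * m choose m) * ?H"
    by (metis dvd_mult mult.assoc mult.commute)
  then show ?thesis
    using central_harmonic_convolution[of m] p_eq by (simp add: cong_dvd_iff)
qed


subsection \<open>Integer polynomials modulo a prime\<close>

definition pcong :: "int poly \<Rightarrow> int poly \<Rightarrow> bool" where
  "pcong f g \<longleftrightarrow> [:int p:] dvd f - g"

lemma pcong_refl: "pcong f f"
  by (simp add: pcong_def)

lemma pcong_add: "pcong f g \<Longrightarrow> pcong f' g' \<Longrightarrow> pcong (f + f') (g + g')"
  unfolding pcong_def add_diff_add by (rule dvd_add)

lemma pcong_mult: "pcong f g \<Longrightarrow> pcong f' g' \<Longrightarrow> pcong (f * f') (g * g')"
  unfolding pcong_def mult_diff_mult by (intro dvd_add dvd_mult dvd_mult2)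

lemma pcong_trans [trans]: "pcong f g \<Longrightarrow> pcong g h \<Longrightarrow> pcong f h"
  unfolding pcong_def using dvd_add[of _ "f - g" "g - h"] by simp

lemma pcong_sum: "(\<And>i. i \<in> I \<Longrightarrow> pcong (f i) (g i)) \<Longrightarrow> pcong (sum f I) (sum g I)"
  unfolding pcong_def sum_subtractf[symmetric] by (rule dvd_sum)

lemma pcong_smult: "[a = b] (mod int p) \<Longrightarrow> pcong (smult a f) (smult b f)"
  unfolding pcong_def smult_diff_left[symmetric] by (auto simp: cong_iff_dvd_diff const_poly_dvd_iff)

text \<open>A prime integer stays prime as a constant polynomial, so F_p[x] has no zero
  divisors.\<close>

lemma pcong_cancel:
  assumes "pcong (h * f) (h * g)" "\<not> [:int p:] dvd h"
  shows "pcong f g"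
  using assms prime_elem_const_poly_iff[of "int p"] prime_int_p
  unfolding pcong_def right_diff_distrib[symmetric] by (simp add: prime_elem_dvd_mult_iff)

lemma pcong_freshman: "pcong ((f + g) ^ p) (f ^ p + g ^ p)"
proof -
  let ?t = "\<lambda>k. of_nat (p choose k) * f ^ k * g ^ (p - k)"
  have "(f + g) ^ p = (\<Sum>k\<le>p. ?t k)" by (rule binomial_ring)
  also have "{..p} = insert 0 (insert p {0<..<p})" by auto
  also have "sum ?t \<dots> = g ^ p + (f ^ p + sum ?t {0<..<p})"
    using p_ge_7 by simp
  finally have "(f + g) ^ p - (f ^ p + g ^ p) = sum ?t {0<..<p}" by simp
  moreover have "[:int p:] dvd sum ?t {0<..<p}"
  proof (rule dvd_sum)
    fix k assume "k \<in> {0<..<p}"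
    then have "p dvd (p choose k)" using dvd_choose_prime[of k p] prime_p by auto
    then have "[:int p:] dvd of_nat (p choose k)" by (metis dvdE dvd_triv_left of_nat_mult of_nat_poly)
    then show "[:int p:] dvd ?t k" by (simp add: mult.assoc)
  qed
  ultimately show ?thesis by (simp add: pcong_def)
qed

text \<open>A vanishing derivative kills every coefficient whose index is prime to \<open>p\<close>,
  leaving a polynomial in x^p, and t^(ip) = t^i by Fermat. The degree bound thus leaves only
  \<open>N\<close> unknown coefficients.\<close>

lemma poly_cong_of_pderiv_0:
  assumes "pcong (pderiv f) 0" and "degree f < N * p"
  shows "[poly f t = (\<Sum>i<N. coeff f (i * p) * t ^ i)] (mod int p)"
proof -
  have *: "int p dvd coeff f k" if "\<not> p dvd k" for k
  proof (cases k)
    case (Suc j)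
    have "int p dvd coeff (pderiv f) j"
      using assms(1) by (simp add: pcong_def const_poly_dvd_iff)
    then have "int p dvd int k * coeff f k" by (simp add: coeff_pderiv Suc del: of_nat_Suc)
    then show ?thesis using prime_int_p that by (auto simp: prime_dvd_mult_iff)
  qed (use that in simp)
  have "poly f t = (\<Sum>k\<le>degree f. coeff f k * t ^ k)" by (rule poly_altdef)
  also have "\<dots> = (\<Sum>k<N * p. coeff f k * t ^ k)"
    by (rule sum.mono_neutral_left) (use assms(2) in \<open>auto simp: coeff_eq_0\<close>)
  also have "[\<dots> = (\<Sum>k<N * p. if p dvd k then coeff f k * t ^ k else 0)] (mod int p)"
    by (rule cong_sum) (use * in \<open>auto simp: cong_0_iff\<close>)
  also have "(\<Sum>k<N * p. if p dvd k then coeff f k * t ^ k else 0)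
     = (\<Sum>k\<in>{k. k < N * p \<and> p dvd k}. coeff f k * t ^ k)"
    by (simp add: sum.If_cases lessThan_def Int_def)
  also have "\<dots> = (\<Sum>i<N. coeff f (i * p) * t ^ (i * p))"
    using p_ge_7 by (intro sum.reindex_bij_witness[of _ "\<lambda>i. i * p" "\<lambda>k. k div p"]) (auto simp: less_mult_imp_div_less)
  also have "[\<dots> = (\<Sum>i<N. coeff f (i * p) * t ^ i)] (mod int p)"
    using cong_pow[OF fermat[of t]] by (intro cong_sum cong_mult cong_refl) (simp add: power_mult mult.commute[of _ p])
  finally show ?thesis .
qed

definition X :: "int poly" where "X = [:0, 1:]"

lemma poly_X [simp]: "poly X t = t"
  by (simp add: X_def)

lemma pderiv_X [simp]: "pderiv X = 1"
  by (simp add: X_def pderiv_pCons)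

lemma degree_X [simp]: "degree X = 1"
  by (simp add: X_def)

text \<open>An antiderivative of \<open>u ^ (e - 1) * (\<Sum>j\<le>N. a j * u ^ j)\<close>, up to the terms with \<open>p dvd e + j\<close>.\<close>

definition antider :: "nat \<Rightarrow> nat \<Rightarrow> (nat \<Rightarrow> int) \<Rightarrow> int poly \<Rightarrow> int poly" where
  "antider N e a u = (\<Sum>j\<le>N. smult (a j * iv (int (e + j))) (u ^ (e + j)))"

lemma poly_antider: "poly (antider N e a u) t = (\<Sum>j\<le>N. a j * iv (int (e + j)) * poly u t ^ (e + j))"
  by (simp add: antider_def poly_sum)

lemma degree_antider: "degree (antider N e a u) \<le> (e + N) * degree u"
  unfolding antider_def
  by (intro degree_sum_le) (auto intro!: order.trans[OF degree_smult_le] order.trans[OF degree_power_le] simp: mult.commute)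

lemma pderiv_antider:
  assumes "e > 0"
  shows "pcong (pderiv (antider N e a u))
     ((\<Sum>j\<in>{j. j \<le> N \<and> \<not> p dvd e + j}. smult (a j) (u ^ (e + j - 1))) * pderiv u)"
proof -
  have "pderiv (antider N e a u)
     = (\<Sum>j\<le>N. smult (a j * (int (e + j) * iv (int (e + j)))) (u ^ (e + j - 1) * pderiv u))"
    unfolding antider_def higher_pderiv_sum[of 1, simplified]
    by (simp add: pderiv_smult pderiv_power mult_ac)
  also have "pcong \<dots> (\<Sum>j\<le>N. smult (a j * (if p dvd e + j then 0 else 1)) (u ^ (e + j - 1) * pderiv u))"
    using iv_eq[of "int (e + _)"] by (intro pcong_sum pcong_smult cong_mult cong_refl) (simp add: int_dvd_int_iff del: of_nat_add)
  also have "\<dots> = (\<Sum>j\<in>{j. j \<le> N \<and> \<not> p dvd e + j}. smult (a j) (u ^ (e + j - 1) * pderiv u))"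
    by (rule sum.mono_neutral_cong_right) auto
  finally show ?thesis by (simp add: sum_distrib_right)
qed

text \<open>The exponents \<open>e + j\<close> lie strictly between 0 and 2p, so the term in
  \<open>u ^ (p - 1)\<close> is the only one that cannot be integrated.\<close>

lemma pderiv_antider_single:
  assumes "e > 0" "e + j0 = p" "e + N < 2 * p" "j0 \<le> N"
  shows "pcong (pderiv (antider N e a u))
     ((u ^ (e - 1) * (\<Sum>j\<le>N. smult (a j) (u ^ j)) - smult (a j0) (u ^ (p - 1))) * pderiv u)"
proof -
  have "p dvd e + j \<longleftrightarrow> j = j0" if "j \<le> N" for j
  proof
    assume "p dvd e + j"
    then obtain q where q: "e + j = p * q" ..
    have "p * q < p * 2" "p * q > 0" using assms that unfolding q[symmetric] by linarith+
    then have "q = 1" using p_ge_7 by simp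
    then show "j = j0" using q assms by simp
  qed (use assms in simp)
  then have "{j. j \<le> N \<and> \<not> p dvd e + j} = {..N} - {j0}" by auto
  moreover have "u ^ (e - 1) * (\<Sum>j\<le>N. smult (a j) (u ^ j)) = (\<Sum>j\<le>N. smult (a j) (u ^ (e + j - 1)))"
    using assms(1) by (simp add: sum_distrib_left Nat.add_diff_assoc2 flip: power_add)
  ultimately have "(\<Sum>j\<in>{j. j \<le> N \<and> \<not> p dvd e + j}. smult (a j) (u ^ (e + j - 1)))
     = u ^ (e - 1) * (\<Sum>j\<le>N. smult (a j) (u ^ j)) - smult (a j0) (u ^ (p - 1))"
    using assms by (simp add: sum_diff1)
  then show ?thesis using pderiv_antider[OF assms(1), of N a u] by simp
qed

text \<open>The substitution x -> 1/x: reversing the sum sends an exponent i to rp - i, which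
  negates its inverse, and s^(rp - i) = s^r t^i.\<close>

lemma antider_reflect:
  assumes "\<And>j. j \<le> N \<Longrightarrow> a (N - j) = a j" and e: "2 * e + N = r * p"
    and st: "[s * t = 1] (mod int p)"
  shows "[poly (antider N e a X) s = - (s ^ r) * poly (antider N e a X) t] (mod int p)"
  unfolding poly_antider poly_X
proof (rule cong_sum_minus_reflect)
  fix j assume j: "j \<le> N"
  have ej: "int (e + (N - j)) = int p * int r - int (e + j)" and ej': "e + (N - j) + (e + j) = p * r"
    using e j by (simp_all add: mult.commute flip: of_nat_mult of_nat_add of_nat_diff)
  \<comment> \<open>Writing 1 as s t completes the exponent of \<open>s\<close> to a multiple of
    \<open>p\<close>, where Fermat applies.\<close>
  have "[s ^ (e + (N - j)) * 1 ^ (e + j) = s ^ (e + (N - j)) * (s * t) ^ (e + j)] (mod int p)"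
    using st by (intro cong_mult cong_pow cong_refl) (rule cong_sym)
  also have "s ^ (e + (N - j)) * (s * t) ^ (e + j) = (s ^ p) ^ r * t ^ (e + j)"
    unfolding power_mult_distrib mult.assoc[symmetric] power_add[symmetric] ej' power_mult[symmetric] ..
  also have "[\<dots> = s ^ r * t ^ (e + j)] (mod int p)"
    by (intro cong_mult cong_pow cong_refl fermat)
  finally have "[s ^ (e + (N - j)) = s ^ r * t ^ (e + j)] (mod int p)" by simp
  then have "[a j * iv (int (e + (N - j))) * s ^ (e + (N - j)) = a j * (- iv (int (e + j))) * (s ^ r * t ^ (e + j))] (mod int p)"
    unfolding ej by (intro cong_mult cong_refl iv_reflect) simp_all
  then show "[a (N - j) * iv (int (e + (N - j))) * s ^ (e + (N - j)) = - (s ^ r) * (a j * iv (int (e + j)) * t ^ (e + j))] (mod int p)"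
    using assms(1)[OF j] by (simp add: mult_ac)
qed


subsection \<open>The relation between the three antiderivatives\<close>

lemma X_power: "X ^ k = monom 1 k"
  by (simp add: X_def monom_altdef)

lemma coeff_antider_X:
  "coeff (antider N e a X) i = (if e \<le> i \<and> i \<le> e + N then a (i - e) * iv (int i) else 0)"
proof -
  have "coeff (antider N e a X) i = (\<Sum>j\<le>N. if e + j = i then a j * iv (int (e + j)) else 0)"
    unfolding antider_def coeff_sum coeff_smult X_power coeff_monom by (intro sum.cong) auto
  also have "\<dots> = (if e \<le> i \<and> i \<le> e + N then a (i - e) * iv (int i) else 0)"
  proof (cases "e \<le> i \<and> i \<le> e + N")
    case True
    then have "(\<Sum>j\<le>N. if e + j = i then a j * iv (int (e + j)) else 0)
        = (\<Sum>j\<le>N. if j = i - e then a (i - e) * iv (int i) else 0)"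
      by (intro sum.cong) auto
    moreover have "i - e \<le> N" using True by linarith
    ultimately show ?thesis using True by simp
  qed (auto intro!: sum.neutral)
  finally show ?thesis .
qed

lemma pcong_obtain:
  assumes "pcong f g"
  obtains h where "f = g + [:int p:] * h"
  using assms unfolding pcong_def by (metis add.commute diff_add_cancel dvdE)

text \<open>The coefficient of the power p - 1, which has no antiderivative, in both integrands: in
  (u (1 - u))^(2m) the sign is (-1)^m = 1, and for \<open>Q\<close> it is the term k = m.\<close>

definition c :: int where "c = int (2 * m choose m)"

text \<open>The binomial expansion of (u (1 - u))^(2m), integrated. The argument stays free because
  \<open>G (1 - X)\<close> is needed as well.\<close>

definition G :: "int poly \<Rightarrow> int poly" where
  "G = antider (2 * m) (2 * m + 1) (\<lambda>j. int (2 * m choose j) * (- 1) ^ j)"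

text \<open>The series of -log(1 - x), truncated after x^(p-1).\<close>

definition L :: "int poly" where
  "L = antider (p - 2) 1 (\<lambda>_. 1) X"

text \<open>The shift 2m + 1 represents 1/3 modulo \<open>p\<close>, as 3(2m + 1) = 2p + 1.\<close>

definition Q :: "int poly" where
  "Q = antider n (2 * m + 1) (\<lambda>k. int (2 * k choose k)) (X * (1 - X))"

lemma pderiv_G:
  "pcong (pderiv (G u)) (((u * (1 - u)) ^ (2 * m) - [:c:] * u ^ (p - 1)) * pderiv u)"
proof -
  have "(1 - u) ^ (2 * m) = (- u + 1) ^ (2 * m)" by simp
  also have "\<dots> = (\<Sum>j\<le>2 * m. smult (int (2 * m choose j) * (- 1) ^ j) (u ^ j))"
    unfolding binomial_ring by (intro sum.cong) (auto simp: of_nat_poly power_minus[of u] smult_power mult_ac minus_one_power_iff)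
  finally have "u ^ (2 * m) * (\<Sum>j\<le>2 * m. smult (int (2 * m choose j) * (- 1) ^ j) (u ^ j)) = (u * (1 - u)) ^ (2 * m)"
    by (simp add: power_mult_distrib)
  then show ?thesis
    using pderiv_antider_single[of "2 * m + 1" m "2 * m" "\<lambda>j. int (2 * m choose j) * (- 1) ^ j" u] m_even p_eq
    unfolding G_def by (simp add: c_def)
qed

text \<open>The factor \<open>1 - X\<close> closes the geometric sum; the derivative comparisons
  below carry it too and cancel it.\<close>

lemma pderiv_L: "pcong ((1 - X) * pderiv L) (1 - X ^ (p - 1))"
proof -
  have "{j. j \<le> p - 2 \<and> \<not> p dvd 1 + j} = {..<p - 1}"
    using p_ge_7 by (auto dest: dvd_imp_le)
  then have "pcong (pderiv L) (\<Sum>j<p - 1. X ^ j)"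
    unfolding L_def using pderiv_antider[of 1 "p - 2" "\<lambda>_. 1" X] by simp
  then have "pcong ((1 - X) * pderiv L) ((1 - X) * (\<Sum>j<p - 1. X ^ j))"
    by (rule pcong_mult[OF pcong_refl])
  then show ?thesis by (simp only: one_diff_power_eq)
qed

lemma one_minus_X_power_p: "pcong ((1 - X) ^ p) (1 - X ^ p)"
  using pcong_freshman[of 1 "- X"] p_odd by simp

text \<open>The sum becomes (1 - 4z)^n = (1 - 2x)^(p-1) with z = x(1 - x). The extra factor, the
  derivative of z, completes a p-th power, on which Frobenius is additive.\<close>

lemma generating_function_mod_p:
  "pcong ((1 - 2 * X) * (\<Sum>k\<le>n. smult (int (2 * k choose k)) ((X * (1 - X)) ^ k))) (1 - 2 * X ^ p)"
proof -
  let ?z = "X * (1 - X)"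
  have "pcong (\<Sum>k\<le>n. smult (int (2 * k choose k)) (?z ^ k)) (\<Sum>k\<le>n. smult (int (n choose k) * (- 4) ^ k) (?z ^ k))"
    by (intro pcong_sum pcong_smult central_binomial_cong) simp
  also have "(\<Sum>k\<le>n. smult (int (n choose k) * (- 4) ^ k) (?z ^ k)) = (smult (- 4) ?z + 1) ^ n"
    unfolding binomial_ring by (intro sum.cong) (simp_all add: of_nat_poly smult_power mult.commute del: smult_minus_left)
  also have "smult (- 4) ?z + 1 = (1 - 2 * X)\<^sup>2"
    by (simp add: X_def power2_eq_square one_pCons numeral_poly)
  also have "((1 - 2 * X)\<^sup>2) ^ n = (1 - 2 * X) ^ (p - 1)"
    unfolding power_mult[symmetric] two_n ..
  finally have "pcong ((1 - 2 * X) * (\<Sum>k\<le>n. smult (int (2 * k choose k)) (?z ^ k))) ((1 - 2 * X) * (1 - 2 * X) ^ (p - 1))"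
    by (rule pcong_mult[OF pcong_refl])
  also have "(1 - 2 * X) * (1 - 2 * X) ^ (p - 1) = (1 + smult (- 2) X) ^ p"
    using p_ge_7 by (simp add: numeral_poly flip: power_Suc)
  also have "pcong \<dots> (1 ^ p + smult (- 2) X ^ p)" by (rule pcong_freshman)
  also have "1 ^ p + smult (- 2) X ^ p = 1 + smult ((- 2) ^ p) (X ^ p)"
    by (simp add: smult_power del: smult_minus_left)
  also have "pcong \<dots> (1 + smult (- 2) (X ^ p))"
    by (intro pcong_add pcong_refl pcong_smult fermat)
  finally show ?thesis by (simp add: numeral_poly)
qed

lemma pderiv_Q:
  "pcong (pderiv Q)
     (((X * (1 - X)) ^ (2 * m) * (\<Sum>k\<le>n. smult (int (2 * k choose k)) ((X * (1 - X)) ^ k))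
        - [:c:] * (X * (1 - X)) ^ (p - 1)) * (1 - 2 * X))"
proof -
  have "pderiv (X * (1 - X)) = 1 - 2 * X" by (simp add: pderiv_mult pderiv_diff)
  moreover have "2 * m + 1 + n < 2 * p" "m \<le> n" using two_n p_eq by linarith+
  ultimately show ?thesis
    using pderiv_antider_single[of "2 * m + 1" m n "\<lambda>k. int (2 * k choose k)" "X * (1 - X)"] p_eq
    unfolding Q_def by (simp add: c_def)
qed

lemma not_dvd_one_minus_X: "\<not> [:int p:] dvd 1 - X"
  using p_ge_7 by (auto simp: const_poly_dvd_iff X_def one_pCons intro!: exI[of _ 0])

lemma X_power_p: "X ^ p = X * X ^ (p - 1)" "(1 - X) ^ p = (1 - X) * (1 - X) ^ (p - 1)"
  using p_ge_7 by (simp_all flip: power_Suc)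

text \<open>The copies of (x(1-x))^(2m) cancel, leaving c ((1-x)^(p-1) - x^(p-1)); times 1 - x this
  is c (1 - x^(p-1)), matching \<open>pderiv_L\<close>.\<close>

lemma G_reflection_pderiv: "pcong (pderiv (G (1 - X) + G X - [:c:] * L)) 0"
proof (rule pcong_cancel[OF _ not_dvd_one_minus_X])
  obtain h1 where h1: "pderiv (G (1 - X)) = ((X * (1 - X)) ^ (2 * m) - [:c:] * (1 - X) ^ (p - 1)) * (- 1) + [:int p:] * h1"
    using pderiv_G[of "1 - X"] by (auto elim: pcong_obtain simp: pderiv_diff mult.commute)
  obtain h2 where h2: "pderiv (G X) = (X * (1 - X)) ^ (2 * m) - [:c:] * X ^ (p - 1) + [:int p:] * h2"
    using pderiv_G[of X] by (auto elim: pcong_obtain)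
  obtain h3 where h3: "(1 - X) * pderiv L = 1 - X ^ (p - 1) + [:int p:] * h3"
    using pderiv_L by (rule pcong_obtain)
  obtain h where h: "(1 - X) * (1 - X) ^ (p - 1) = 1 - X * X ^ (p - 1) + [:int p:] * h"
    using one_minus_X_power_p unfolding X_power_p by (rule pcong_obtain)
  have d: "pderiv (G (1 - X) + G X - [:c:] * L) = pderiv (G (1 - X)) + pderiv (G X) - [:c:] * pderiv L"
    by (simp add: pderiv_add pderiv_diff pderiv_smult)
  define C P where "C = [:c:]" and "P = [:int p:]"
  have "(1 - X) * pderiv (G (1 - X) + G X - C * L)
      = C * ((1 - X) * (1 - X) ^ (p - 1)) - C * (1 - X) * X ^ (p - 1)
        + P * ((1 - X) * (h1 + h2)) - C * ((1 - X) * pderiv L)"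
    unfolding d[folded C_def] h1[folded C_def P_def] h2[folded C_def P_def] by (simp add: algebra_simps)
  also have "\<dots> = P * (C * h + (1 - X) * (h1 + h2) - C * h3)"
    unfolding h[folded P_def] h3[folded P_def] by (simp add: algebra_simps)
  finally show "pcong ((1 - X) * pderiv (G (1 - X) + G X - [:c:] * L)) ((1 - X) * 0)"
    unfolding pcong_def C_def P_def mult_zero_right diff_0_right by (rule dvdI)
qed

text \<open>Modulo \<open>p\<close>, x^p differentiates to 0. After multiplication by 1 - x the
  terms in (x(1-x))^(2m) cancel by the generating function, and the multiples of \<open>c\<close>
  cancel once (1-x)^p is replaced by 1 - x^p.\<close>

lemma Q_relation_pderiv: "pcong (pderiv (Q - (1 - 2 * X ^ p) * G X - [:c:] * X ^ p * L)) 0"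
proof (rule pcong_cancel[OF _ not_dvd_one_minus_X])
  let ?D = "Q - (1 - 2 * X ^ p) * G X - [:c:] * X ^ p * L"
  define B where "B = (\<Sum>k\<le>n. smult (int (2 * k choose k)) ((X * (1 - X)) ^ k))"
  define Y where "Y = X ^ (p - 1)"
  define V where "V = (1 - X) ^ (p - 1)"
  define A where "A = (X * (1 - X)) ^ (2 * m)"
  obtain h2 where h2: "pderiv (G X) = A - [:c:] * Y + [:int p:] * h2"
    using pderiv_G[of X] by (auto elim: pcong_obtain simp: A_def Y_def)
  obtain h3 where h3: "(1 - X) * pderiv L = 1 - Y + [:int p:] * h3"
    using pderiv_L unfolding Y_def by (rule pcong_obtain)
  obtain h where h: "(1 - X) * V = 1 - X * Y + [:int p:] * h"
    using one_minus_X_power_p unfolding X_power_p V_def Y_def by (rule pcong_obtain)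
  obtain h5 where h5: "pderiv Q = (A * B - [:c:] * (Y * V)) * (1 - 2 * X) + [:int p:] * h5"
    using pderiv_Q unfolding B_def[symmetric] A_def[symmetric] power_mult_distrib[of X "1 - X" "p - 1"] Y_def V_def
    by (rule pcong_obtain)
  obtain h6 where h6: "(1 - 2 * X) * B = 1 - 2 * (X * Y) + [:int p:] * h6"
    using generating_function_mod_p unfolding B_def X_power_p Y_def by (rule pcong_obtain)
  have X': "pderiv (X ^ p) = [:int p:] * Y"
    by (simp add: pderiv_power Y_def)
  have "pderiv ?D = pderiv Q - (1 - 2 * X ^ p) * pderiv (G X) + 2 * pderiv (X ^ p) * G X
      - [:c:] * pderiv (X ^ p) * L - [:c:] * X ^ p * pderiv L"
    by (simp add: pderiv_add pderiv_diff pderiv_mult pderiv_smult smult_add_right algebra_simps)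
  also have "\<dots> = pderiv Q - (1 - 2 * (X * Y)) * pderiv (G X) + 2 * ([:int p:] * Y) * G X
      - [:c:] * ([:int p:] * Y) * L - [:c:] * (X * Y) * pderiv L"
    unfolding X' unfolding X_power_p Y_def ..
  finally have d: "pderiv ?D = \<dots>" .
  define C P where "C = [:c:]" and "P = [:int p:]"
  have "(1 - X) * pderiv ?D = (1 - X) * A * ((1 - 2 * X) * B) - C * Y * (1 - 2 * X) * ((1 - X) * V)
      - (1 - X) * (1 - 2 * (X * Y)) * (A - C * Y) - C * (X * Y) * ((1 - X) * pderiv L)
      + P * ((1 - X) * h5 + 2 * (1 - X) * Y * G X - (1 - X) * (1 - 2 * (X * Y)) * h2 - (1 - X) * C * Y * L)"
    unfolding d h2 h5 unfolding C_def[symmetric] P_def[symmetric] by (simp add: algebra_simps)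
  also have "\<dots> = P * ((1 - X) * A * h6 - C * Y * (1 - 2 * X) * h + (1 - X) * h5
     + 2 * (1 - X) * Y * G X - (1 - X) * (1 - 2 * (X * Y)) * h2 - (1 - X) * C * Y * L - C * (X * Y) * h3)"
    unfolding h[folded P_def] h3[folded P_def] h6[folded P_def] by (simp add: algebra_simps)
  finally show "pcong ((1 - X) * pderiv ?D) ((1 - X) * 0)"
    unfolding pcong_def P_def mult_zero_right diff_0_right by (rule dvdI)
qed

section \<open>Boundary values and the substitutions x -> 1/x and x -> 1 - x\<close>

lemma G_L_at_0: "poly (G X) 0 = 0" "poly L 0 = 0" "poly Q 0 = 0" "poly Q 1 = 0"
  by (simp_all add: G_def L_def Q_def poly_antider)

text \<open>Here r = 2, because 2(2m + 1) + 2m = 2p; the coefficients are palindromic as 2m is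
  even.\<close>

lemma G_reflect:
  "[s * t = 1] (mod int p) \<Longrightarrow> [poly (G X) s = - (s ^ 2) * poly (G X) t] (mod int p)"
  unfolding G_def using p_eq
  by (intro antider_reflect) (auto simp: binomial_symmetric[symmetric] minus_one_power_iff)

lemma L_reflect:
  "[s * t = 1] (mod int p) \<Longrightarrow> [poly L s = - s * poly L t] (mod int p)"
  unfolding L_def using p_ge_7 antider_reflect[of "p - 2" "\<lambda>_. 1" 1 1 s t] by simp

lemma int_p_dvd_half: "int p dvd 2 * k \<Longrightarrow> int p dvd k"
  using cong_cancel[of 2 k 0] not_dvd_small[of 2] p_ge_7 by (simp add: cong_0_iff)

text \<open>At the fixed point 1 of x -> 1/x each value is its own negative.\<close>

lemma G_L_at_1: "int p dvd poly (G X) 1" "int p dvd poly L 1"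
  using G_reflect[of 1 1] L_reflect[of 1 1] by (auto intro!: int_p_dvd_half simp: cong_iff_dvd_diff)

lemma poly_G_one_minus_X: "poly (G (1 - X)) t = poly (G X) (1 - t)"
  by (simp add: G_def poly_antider)

lemma degree_one_minus_X: "degree (1 - X) = 1"
  by (simp add: X_def one_pCons)

lemma degree_G_L_Q:
  "degree (G X) \<le> 4 * m + 1" "degree (G (1 - X)) \<le> 4 * m + 1" "degree L \<le> p - 1"
  "degree Q \<le> 7 * m + 2"
proof -
  have "degree (X * (1 - X)) \<le> 2"
    using degree_mult_le[of X "1 - X"] by (simp add: degree_one_minus_X)
  then have "degree Q \<le> (2 * m + 1 + n) * 2"
    unfolding Q_def by (rule order.trans[OF degree_antider mult_le_mono2])
  moreover have "2 * n = 3 * m" using two_n p_eq by simp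
  ultimately show "degree Q \<le> 7 * m + 2" by (simp add: algebra_simps)
  show "degree L \<le> p - 1" 
    using degree_antider[of "p - 2" 1 "\<lambda>_. 1" X] p_ge_7 unfolding L_def degree_X mult_1_right by linarith
qed (use degree_antider[of "2 * m" "2 * m + 1" _ X] degree_antider[of "2 * m" "2 * m + 1" _ "1 - X"]
  in \<open>simp_all add: G_def degree_one_minus_X\<close>)

text \<open>The difference of the sides has derivative 0 and degree below 2p, so its values are a +
  b t; it vanishes at 0 and 1.\<close>

lemma G_reflection: "[poly (G X) (1 - t) + poly (G X) t = c * poly L t] (mod int p)"
proof -
  let ?E = "G (1 - X) + G X - [:c:] * L"
  have "degree ?E \<le> 4 * m + 1"
    by (intro degree_diff_le degree_add_le) (use degree_G_L_Q p_eq in \<open>auto intro: order.trans[OF degree_smult_le]\<close>)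
  then have "degree ?E < 2 * p" using p_eq by simp
  from poly_cong_of_pderiv_0[OF G_reflection_pderiv this]
  have E: "[poly ?E t = coeff ?E 0 + coeff ?E p * t] (mod int p)" for t
    by (simp add: numeral_2_eq_2)
  have "int p dvd poly ?E 0" "int p dvd poly ?E 1"
    using G_L_at_0 G_L_at_1 by (simp_all add: poly_G_one_minus_X)
  then have "int p dvd coeff ?E 0" "int p dvd coeff ?E 0 + coeff ?E p"
    using cong_dvd_iff[OF E[of 0]] cong_dvd_iff[OF E[of 1]]
    by (simp_all only: mult_zero_right mult_1_right add_0_right)
  then have "int p dvd coeff ?E 0 + coeff ?E p * t" by (simp add: dvd_add_right_iff)
  then have "int p dvd poly ?E t" using cong_dvd_iff[OF E[of t]] by blast
  then show ?thesis by (simp add: poly_G_one_minus_X cong_iff_dvd_diff)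
qed

text \<open>For j = m - k the exponent is p - j, so x^p has coefficient (-1)^j C(p-j,j), which is
  C(2j,j)/2 for j > 0, and the inverse of p - j is -1/j. Twice the coefficient is therefore minus
  the vanishing convolution.\<close>

lemma coeff_Q_p: "int p dvd coeff Q p"
proof -
  let ?a = "\<lambda>k. int (2 * k choose k) * iv (int (2 * m + 1 + k))"
  let ?b = "\<lambda>k. 2 * (?a k * ((- 1) ^ (m - k) * int ((2 * m + 1 + k) choose (m - k))))"
  have co: "coeff ((X * (1 - X)) ^ (2 * m + 1 + k)) p
     = (if k \<le> m then (- 1) ^ (m - k) * int ((2 * m + 1 + k) choose (m - k)) else 0)" for k
  proof -
    have "1 - X = [:1, - 1:]" by (simp add: X_def one_pCons)
    then have "(X * (1 - X)) ^ (2 * m + 1 + k) = monom 1 (2 * m + 1 + k) * [:1, - 1:] ^ (2 * m + 1 + k)"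
      by (simp only: power_mult_distrib X_power)
    then show ?thesis
      using coeff_linear_poly_power[of "m - k" "2 * m + 1 + k" 1 "- 1 :: int"] p_eq
      by (auto simp: coeff_monom_mult simp del: power_Suc)
  qed
  have 1: "2 * coeff Q p = (\<Sum>k\<le>n. if k \<le> m then ?b k else 0)"
    unfolding Q_def antider_def coeff_sum coeff_smult co sum_distrib_left by (intro sum.cong) auto
  have 2: "(\<Sum>k\<le>n. if k \<le> m then ?b k else 0) = (\<Sum>k\<le>m. ?b k)"
    using two_n p_eq by (intro sum.mono_neutral_cong_right) auto
  have "[(\<Sum>k\<le>m. ?b k) = (- 1) * (\<Sum>j\<le>m. int (2 * (m - j) choose (m - j)) * int (2 * j choose j) * iv (int j))] (mod int p)"
  proof (rule cong_sum_minus_reflect)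
    fix j assume j: "j \<le> m"
    let ?f = "int (2 * (m - j) choose (m - j))"
    have e: "2 * m + 1 + (m - j) = p - j" "int (p - j) = int p * 1 - int j" "m - (m - j) = j"
      using j p_eq by auto
    have "[?f * iv (int (p - j)) * (2 * ((- 1) ^ j * int ((p - j) choose j)))
         = ?f * (- iv (int j)) * int (2 * j choose j)] (mod int p)"
    proof (cases "j = 0")
      \<comment> \<open>The exponent is \<open>p\<close> itself; both sides vanish because
        \<open>iv\<close> is 0 at multiples of \<open>p\<close>.\<close>
      case True
      then show ?thesis using iv_p by (simp add: iv_0 cong_0_iff)
    next
      case False
      then show ?thesis unfolding e(2)
        by (intro cong_mult cong_refl iv_reflect binomial_p_minus) (use j p_eq in auto)
    qed
    then show "[?b (m - j) = (- 1) * (?f * int (2 * j choose j) * iv (int j))] (mod int p)"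
      unfolding e by (simp add: mult_ac)
  qed
  from cong_dvd_iff[OF this] have "int p dvd 2 * coeff Q p"
    unfolding 1 2 using dvd_mult[OF central_harmonic_vanishes, of "- 1"] by blast
  then show ?thesis by (rule int_p_dvd_half)
qed

text \<open>The difference of the sides takes the values a + b t + d t^2. Evaluation at 0 kills a,
  \<open>coeff_Q_p\<close> kills b, and evaluation at 1 then kills d.\<close>

lemma Q_relation: "[poly Q t = (1 - 2 * t ^ p) * poly (G X) t + c * t ^ p * poly L t] (mod int p)"
proof -
  let ?D = "Q - (1 - 2 * X ^ p) * G X - [:c:] * X ^ p * L"
  have "degree ((1 - 2 * X ^ p) * G X) \<le> p + (4 * m + 1)"
  proof (intro order.trans[OF degree_mult_le] add_mono)
    show "degree (1 - 2 * X ^ p) \<le> p"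
      by (intro degree_diff_le) (simp_all add: X_power numeral_poly degree_monom_le smult_monom)
  qed (rule degree_G_L_Q)
  moreover have "degree ([:c:] * X ^ p * L) \<le> p + (p - 1)"
    by (intro order.trans[OF degree_mult_le] add_mono degree_G_L_Q) (simp add: X_power smult_monom degree_monom_le)
  ultimately have "degree ?D < 3 * p"
    using degree_G_L_Q(4) p_eq by (intro degree_diff_less) auto
  from poly_cong_of_pderiv_0[OF Q_relation_pderiv this]
  have D: "[poly ?D t = coeff ?D 0 + coeff ?D p * t + coeff ?D (2 * p) * t\<^sup>2] (mod int p)" for t
    by (simp add: eval_nat_numeral)
  have z: "coeff (G X) 0 = 0" "coeff L 0 = 0" "int p dvd coeff (G X) p"
    using iv_p by (auto simp: G_def L_def coeff_antider_X cong_0_iff)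
  have e: "coeff ?D p = coeff Q p - coeff (G X) p + 2 * coeff (G X) 0 - c * coeff L 0"
    by (simp add: left_diff_distrib X_power coeff_monom_mult numeral_poly mult.assoc)
  have d1: "int p dvd coeff ?D p" unfolding e using z coeff_Q_p by simp
  have "int p dvd poly ?D 0" "int p dvd poly ?D 1"
    using G_L_at_0 G_L_at_1 p_ge_7 by simp_all
  then have d0: "int p dvd coeff ?D 0" and "int p dvd coeff ?D 0 + coeff ?D p + coeff ?D (2 * p)"
    using cong_dvd_iff[OF D[of 0]] cong_dvd_iff[OF D[of 1]]
    by (simp_all only: mult_zero_right mult_1_right add_0_right zero_power2 one_power2)
  then have "int p dvd coeff ?D (2 * p)"
    using dvd_add[OF d0 d1] by (simp only: dvd_add_right_iff)
  then have "int p dvd coeff ?D 0 + coeff ?D p * t + coeff ?D (2 * p) * t\<^sup>2"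
    using d0 d1 by (intro dvd_add dvd_mult2)
  then have "int p dvd poly ?D t" using cong_dvd_iff[OF D[of t]] by blast
  then show ?thesis by (simp add: cong_iff_dvd_diff algebra_simps)
qed

section \<open>Evaluation at a primitive sixth root of unity\<close>

lemma Q_at_sixth_root:
  assumes t: "int p dvd t\<^sup>2 - t + 1"
  shows "int p dvd poly Q t"
proof -
  \<comment> \<open>This is also the inverse of \<open>t\<close>, so both substitutions lead to the
    same point.\<close>
  define s where "s = 1 - t"
  have "1 - s * t = t\<^sup>2 - t + 1" by (simp add: s_def power2_eq_square algebra_simps)
  then have st: "[s * t = 1] (mod int p)" using t by (metis cong_iff_dvd_diff cong_sym)
  have "\<not> int p dvd 3" using not_dvd_small[of 3] p_ge_7 by simp
  have s1: "\<not> int p dvd 1 + s"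
  proof
    assume "int p dvd 1 + s"
    then have "int p dvd (t\<^sup>2 - t + 1) + (1 + s) * (t + 1)" using t by simp
    also have "(t\<^sup>2 - t + 1) + (1 + s) * (t + 1) = 3"
      by (simp add: s_def power2_eq_square algebra_simps)
    finally show False using \<open>\<not> int p dvd 3\<close> by blast
  qed
  have t0: "\<not> int p dvd t"
  proof
    assume "int p dvd t"
    then have "int p dvd 1" using cong_dvd_iff[OF st] by simp
    then show False using p_ge_7 by simp
  qed
  let ?g = "poly (G X)" and ?l = "poly L"
  have "int p dvd ?g s + ?g t - c * ?l t" (is "_ dvd ?a")
    using G_reflection[of t] by (simp add: cong_iff_dvd_diff s_def)
  moreover have "int p dvd ?g t + ?g s - c * ?l s" (is "_ dvd ?b")
    using G_reflection[of s] by (simp add: cong_iff_dvd_diff s_def)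
  moreover have "int p dvd ?l s + s * ?l t" (is "_ dvd ?d")
    using L_reflect[OF st] by (simp add: cong_iff_dvd_diff)
  moreover have "int p dvd ?g s + s\<^sup>2 * ?g t" (is "_ dvd ?e")
    using G_reflect[OF st] by (simp add: cong_iff_dvd_diff)
  \<comment> \<open>The first combination joins c L(s) = c L(t) with L(s) = -s L(t); the second
    equates the two expressions for G(s).\<close>
  ultimately have "int p dvd ?b - ?a + c * ?d" and ea: "int p dvd ?e - ?a"
    by (blast intro: dvd_add dvd_diff dvd_mult)+
  moreover have "?b - ?a + c * ?d = (1 + s) * (c * ?l t)" by (simp add: algebra_simps)
  ultimately have "int p dvd (1 + s) * (c * ?l t)" by (simp only:)
  then have l: "int p dvd c * ?l t"
    using prime_dvd_multD[OF prime_int_p] s1 by blast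
  with ea have "int p dvd ?e - ?a - c * ?l t" by (rule dvd_diff)
  \<comment> \<open>Here s^2 - 1 = -t (1 + s).\<close>
  moreover have "?e - ?a - c * ?l t = - (t * (1 + s) * ?g t)"
    by (simp add: s_def power2_eq_square algebra_simps)
  ultimately have "int p dvd t * (1 + s) * ?g t" by simp
  then have "int p dvd ?g t" using s1 t0 prime_int_p by (auto simp: prime_dvd_mult_iff)
  then have "int p dvd (1 - 2 * t ^ p) * ?g t + t ^ p * (c * ?l t)" using l by simp
  then show ?thesis using cong_dvd_iff[OF Q_relation[of t]] by (simp only: mult_ac)
qed

lemma inverse_sum_mod_p: "int p dvd (\<Sum>k\<le>n. int (2 * k choose k) * iv (int (3 * k + 1)))"
proof -
  obtain t where t: "int p dvd t\<^sup>2 - t + 1" using sixth_root_exists by blast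
  have z: "[t * (1 - t) = 1] (mod int p)"
    using t by (simp add: cong_iff_dvd_diff power2_eq_square algebra_simps dvd_diff_commute)
  have pz: "poly (X * (1 - X)) t = t * (1 - t)" by simp
  have "[iv 3 * poly Q t = (\<Sum>k\<le>n. int (2 * k choose k) * iv (int (3 * k + 1)))] (mod int p)"
    unfolding Q_def poly_antider sum_distrib_left
  proof (rule cong_sum)
    fix k
    \<comment> \<open>Multiplication by 3 turns the exponents of \<open>Q\<close> into the
      denominators 3k + 1.\<close>
    have "3 * int (2 * m + 1 + k) - int (3 * k + 1) = int p * 2" using p_eq by simp
    then have "[iv (3 * int (2 * m + 1 + k)) = iv (int (3 * k + 1))] (mod int p)"
      by (intro iv_cong) (metis cong_iff_dvd_diff dvd_triv_left)
    then have "[int (2 * k choose k) * iv (3 * int (2 * m + 1 + k)) * (t * (1 - t)) ^ (2 * m + 1 + k)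
       = int (2 * k choose k) * iv (int (3 * k + 1)) * 1 ^ (2 * m + 1 + k)] (mod int p)"
      by (intro cong_mult cong_pow cong_refl z)
    then show "[iv 3 * (int (2 * k choose k) * iv (int (2 * m + 1 + k)) * poly (X * (1 - X)) t ^ (2 * m + 1 + k))
       = int (2 * k choose k) * iv (int (3 * k + 1))] (mod int p)"
      unfolding iv_mult pz by (simp only: power_one mult_1_left mult_1_right mult_ac)
  qed
  from cong_dvd_iff[OF this] show ?thesis using Q_at_sixth_root[OF t] by simp
qed

section \<open>From inverses modulo p to fractions\<close>

lemma cong_zero_loc_sum:
  fixes a d :: "'i \<Rightarrow> nat"
  assumes "finite A" and d: "\<And>k. k \<in> A \<Longrightarrow> \<not> p dvd d k"
    and "int p dvd (\<Sum>k\<in>A. int (a k) * iv (int (d k)))"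
  shows "cong_zero_loc (\<Sum>k\<in>A. of_nat (a k) / of_nat (d k)) p"
proof -
  define b where "b = (\<Prod>k\<in>A. int (d k))"
  define N where "N = (\<Sum>k\<in>A. int (a k) * (\<Prod>i\<in>A - {k}. int (d i)))"
  have d0: "d k \<noteq> 0" if "k \<in> A" for k using d[OF that] by (metis dvd_0_right)
  have b: "\<not> int p dvd b"
    unfolding b_def using d assms(1) prime_int_p by (auto simp: prime_dvd_prod_iff)
  have split: "b = int (d k) * (\<Prod>i\<in>A - {k}. int (d i))" if "k \<in> A" for k
    unfolding b_def by (rule prod.remove[OF assms(1) that])
  \<comment> \<open>Clearing the common denominator \<open>b\<close> turns the sum of modular
    inverses into the numerator \<open>N\<close> of the rational sum.\<close>
  have "[b * (\<Sum>k\<in>A. int (a k) * iv (int (d k))) = N] (mod int p)"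
    unfolding N_def sum_distrib_left
  proof (rule cong_sum)
    fix k assume k: "k \<in> A"
    have "[int (a k) * (\<Prod>i\<in>A - {k}. int (d i)) * (int (d k) * iv (int (d k)))
       = int (a k) * (\<Prod>i\<in>A - {k}. int (d i)) * 1] (mod int p)"
      using iv_eq[of "int (d k)"] d[OF k] by (intro cong_mult cong_refl) simp
    then show "[b * (int (a k) * iv (int (d k))) = int (a k) * (\<Prod>i\<in>A - {k}. int (d i))] (mod int p)"
      unfolding split[OF k] by (simp add: mult_ac)
  qed
  from cong_dvd_iff[OF this] have N: "int p dvd N" using assms(3) by simp
  have "(of_nat (a k) / of_nat (d k) :: rat) = of_int (int (a k) * (\<Prod>i\<in>A - {k}. int (d i))) / of_int b"
    if "k \<in> A" for k
  proof -
    have "(\<Prod>i\<in>A - {k}. int (d i)) \<noteq> 0" using d0 assms(1) by simp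
    then show ?thesis unfolding split[OF that] using d0[OF that] by (simp del: of_int_prod)
  qed
  then have "(\<Sum>k\<in>A. of_nat (a k) / of_nat (d k) :: rat) = of_int N / of_int b"
    by (simp add: N_def sum_divide_distrib)
  then show ?thesis
    unfolding cong_zero_loc_def using b N by (intro exI[of _ N] exI[of _ b]) auto
qed

end

theorem theorem1p3:
  fixes p :: nat
  assumes "prime p" and "p mod 3 = 1"
  shows "cong_zero_loc
           (\<Sum>k \<in> {0..(p - 1) div 2} - {(p - 1) div 3}.
              of_nat ((2 * k) choose k) / of_nat (3 * k + 1)) p"
proof -
  define m where "m = p div 3"
  have p: "p = 3 * m + 1" using assms(2) unfolding m_def by presburger
  interpret prime_mod_3 p m by unfold_locales (use assms(1) p in auto)
  let ?A = "{0..n} - {m}"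
  have "m \<le> n" using two_n p by linarith
  have nd: "\<not> p dvd 3 * k + 1" if "k \<in> ?A" for k
  proof
    assume "p dvd 3 * k + 1"
    then obtain q where q: "3 * k + 1 = p * q" ..
    \<comment> \<open>As k is at most (p-1)/2, 3k + 1 < 2p, so the only possible multiple is
      \<open>p\<close>, reached at the excluded k = m.\<close>
    have "p * q < p * 2" "p * q > 0" using that two_n p_ge_7 unfolding q[symmetric] by auto
    then have "q = 1" by simp
    then show False using q that p by simp
  qed
  \<comment> \<open>The split-off term k = m contains \<open>iv\<close> at \<open>p\<close> and so
    vanishes.\<close>
  have "(\<Sum>k\<le>n. int (2 * k choose k) * iv (int (3 * k + 1)))
     = int (2 * m choose m) * iv (int (3 * m + 1)) + (\<Sum>k\<in>?A. int (2 * k choose k) * iv (int (3 * k + 1)))"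
    unfolding atLeast0AtMost[symmetric] by (rule sum.remove) (use \<open>m \<le> n\<close> in auto)
  then have "int p dvd (\<Sum>k\<in>?A. int (2 * k choose k) * iv (int (3 * k + 1)))"
    using inverse_sum_mod_p iv_p unfolding p[symmetric] by (simp add: cong_0_iff dvd_add_right_iff)
  then have "cong_zero_loc (\<Sum>k\<in>?A. of_nat (2 * k choose k) / of_nat (3 * k + 1)) p"
    by (intro cong_zero_loc_sum) (use nd in auto)
  moreover have "(p - 1) div 2 = n" by (simp add: n_def)
  moreover have "(p - 1) div 3 = m" by (simp add: p_eq)
  ultimately show ?thesis by simp
qed

end
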